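(* Let $b>0$ and $\nu\in\mathbb{R}$ with $1+b\nu>0$. For any $k,l\in\mathbb{Z}_{\geq0}$ there exists a constant $C=C_{k,l,b,\nu}>0$ such that $$\left|\frac{\partial^k}{\partial w^k}\frac{\partial^l}{\partial t^l}\mathscr{I}(b,\nu,w,t)\right|\le C\,|w|^{-k}$$ for all $t\in[-1,1]$ and all $w\in\mathbb{C}\setminus\{0\}$ with $|w|$ sufficiently small.
   Context: Normalized I-Bessel function: for $\mu\in\mathbb{R}$ and $w\in\mathbb{C}$, $\tilde I_\mu(w)=\sum_{j=0}^\infty\frac{(w/2)^{2j}}{j!\,\Gamma(\mu+j+1)}$ (with $1/\Gamma=0$ at the poles of $\Gamma$). Normalized Gegenbauer polynomials $\check C^\nu_m(t)$ ($\nu\in\mathbb{R}$, $m\in\mathbb{N}=\{0,1,2,\dots\}$) are defined by the formal power series expansion $\frac{1-x^2}{(1-2tx+x^2)^{\nu+1}}=\sum_{m=0}^\infty\check C^\nu_m(t)x^m$. For $b>0$, $\nu\in\mathbb{R}$ with $1+b\nu>0$, $w\in\mathbb{C}$, $t\in[-1,1]$, $$\mathscr{I}(b,\nu,w,t):=\Gamma(b\nu+1)\sum_{m=0}^\infty\left(\frac w2\right)^{bm}\tilde I_{b(m+\nu)}(w)\,\check C^\nu_m(t),$$ a series which converges absolutely and locally uniformly. For $w=|w|e^{i\alpha}$ with $\alpha\in(-\pi,\pi]$, $(w/2)^s=(|w|/2)^se^{i\alpha s}$; derivatives in $w$ are those of the local holomorphic branch (so $\frac{d}{dw}(w/2)^s=\frac{s}{w}(w/2)^s$).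 *)

theory Defs
  imports "HOL-Complex_Analysis.Complex_Analysis"
begin

(* rGamma is the entire function 1/Gamma, hence 0 at the poles of Gamma. *)
definition bessel_I_tilde :: "real \<Rightarrow> complex \<Rightarrow> complex" where
  "bessel_I_tilde \<mu> w =
     (\<Sum>j. (w / 2) ^ (2 * j) / fact j * of_real (rGamma (\<mu> + real j + 1)))"

(* fps_binomial a is the formal series (1 + X)^a, so the denominator below is
   (1 - 2 t X + X^2)^(\<nu> + 1).  Its constant coefficient is 1, so the quotient is a genuine one;
   see gegenbauer_check_generating. *)
definition gegenbauer_check :: "real \<Rightarrow> nat \<Rightarrow> real \<Rightarrow> real" where
  "gegenbauer_check \<nu> m t =
     fps_nth ((1 - fps_X ^ 2) /
       fps_compose (fps_binomial (\<nu> + 1)) (fps_X ^ 2 - fps_const (2 * t) * fps_X)) m"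

lemma gegenbauer_check_generating:
  "Abs_fps (\<lambda>m. gegenbauer_check \<nu> m t) *
     fps_compose (fps_binomial (\<nu> + 1)) (fps_X ^ 2 - fps_const (2 * t) * fps_X) = 1 - fps_X ^ 2"
proof -
  let ?D = "fps_compose (fps_binomial (\<nu> + 1)) (fps_X ^ 2 - fps_const (2 * t) * fps_X)"
  have "fps_nth ?D 0 \<noteq> 0" by simp
  then have "inverse ?D * ?D = 1" by (rule inverse_mult_eq_1)
  moreover have "Abs_fps (\<lambda>m. gegenbauer_check \<nu> m t) = (1 - fps_X ^ 2) / ?D"
    by (rule fps_ext) (simp add: gegenbauer_check_def)
  ultimately show ?thesis
    using \<open>fps_nth ?D 0 \<noteq> 0\<close> by (simp add: fps_divide_unit mult.assoc)
qed

(* For z \<noteq> 0 the library's powr is |z|^s exp(i s Arg z) with Arg z in (-pi, pi]; the case distinction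
   only serves to have 0^0 = 1, whereas 0 powr 0 = 0. *)
definition principal_power :: "complex \<Rightarrow> real \<Rightarrow> complex" where
  "principal_power z s = (if s = 0 then 1 else z powr of_real s)"

(* As a function of z, the holomorphic branch of z^s on a neighbourhood of z0 \<noteq> 0 that takes the
   principal value at z0.  Unlike principal_power it is holomorphic near z0 also when z0 is on the
   negative real axis. *)
definition local_power :: "complex \<Rightarrow> complex \<Rightarrow> real \<Rightarrow> complex" where
  "local_power z0 z s = principal_power z0 s * principal_power (z / z0) s"

(* The series for a given choice pw of complex powers. *)
definition scriptI_series ::
    "(complex \<Rightarrow> real \<Rightarrow> complex) \<Rightarrow> real \<Rightarrow> real \<Rightarrow> complex \<Rightarrow> real \<Rightarrow> complex" where
  "scriptI_series pw b \<nu> w t =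
     of_real (Gamma (b * \<nu> + 1)) *
     (\<Sum>m. pw (w / 2) (b * real m) * bessel_I_tilde (b * (real m + \<nu>)) w *
          of_real (gegenbauer_check \<nu> m t))"

definition scriptI :: "real \<Rightarrow> real \<Rightarrow> complex \<Rightarrow> real \<Rightarrow> complex" where
  "scriptI = scriptI_series principal_power"

definition scriptI_branch :: "complex \<Rightarrow> real \<Rightarrow> real \<Rightarrow> complex \<Rightarrow> real \<Rightarrow> complex" where
  "scriptI_branch w0 = scriptI_series (local_power (w0 / 2))"

(* scriptI is a function of t in [-1,1] only, so derivatives at t = -1 and t = 1 are one-sided. *)
definition t_deriv :: "(real \<Rightarrow> complex) \<Rightarrow> real \<Rightarrow> complex" where
  "t_deriv f t = vector_derivative f (at t within {-1..1})"

(* The k-th w-derivative of the l-th t-derivative at (w, t), w \<noteq> 0, the former being that of the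
   local holomorphic branch at w. *)
definition scriptI_deriv ::
    "nat \<Rightarrow> nat \<Rightarrow> real \<Rightarrow> real \<Rightarrow> complex \<Rightarrow> real \<Rightarrow> complex" where
  "scriptI_deriv k l b \<nu> w t =
     (deriv ^^ k) (\<lambda>z. (t_deriv ^^ l) (\<lambda>s. scriptI_branch w b \<nu> z s) t) w"

lemma principal_power_polar:
  assumes "z \<noteq> 0"
  shows "principal_power z s = of_real (norm z powr s) * cis (s * Arg z)"
proof -
  have "z powr of_real s = exp (of_real s * (of_real (ln (norm z)) + \<i> * of_real (Arg z)))"
    using assms by (simp add: powr_def Ln_Arg)
  also have "\<dots> = of_real (norm z powr s) * cis (s * Arg z)"
    using assms
    by (simp add: powr_def distrib_left exp_add exp_of_real [symmetric] cis_conv_exp mult.left_commute)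
  finally show ?thesis using assms by (simp add: principal_power_def)
qed

lemma local_power_self: "z \<noteq> 0 \<Longrightarrow> local_power z z s = principal_power z s"
  by (simp add: local_power_def principal_power_def)

lemma local_power_has_field_derivative:
  assumes "z \<noteq> 0"
  shows "((\<lambda>x. local_power z x s) has_field_derivative of_real s / z * principal_power z s) (at z)"
proof (cases "s = 0")
  case False
  have "((\<lambda>x. z powr of_real s * (x / z) powr of_real s) has_field_derivative
      z powr of_real s * (of_real s / z)) (at z)"
    using assms by (auto intro!: derivative_eq_intros)
  then show ?thesis using False by (simp add: local_power_def principal_power_def mult.commute)
qed (simp add: local_power_def principal_power_def)

lemma scriptI_branch_self: "w \<noteq> 0 \<Longrightarrow> scriptI_branch w b \<nu> w t = scriptI b \<nu> w t"
  by (simp add: scriptI_branch_def scriptI_def scriptI_series_def local_power_self)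

lemma eventually_local_power_eq:
  assumes "z0 \<notin> \<real>\<^sub>\<le>\<^sub>0"
  shows "eventually (\<lambda>z. \<forall>s. local_power z0 z s = principal_power z s) (nhds z0)"
proof -
  have z0: "z0 \<noteq> 0" using assms by auto
  have "((\<lambda>z. Im (Ln z0) + Im (Ln (z / z0))) \<longlongrightarrow> Im (Ln z0) + Im (Ln (z0 / z0))) (nhds z0)"
    using z0 by (intro tendsto_intros filterlim_ident) auto
  then have lim: "((\<lambda>z. Im (Ln z0) + Im (Ln (z / z0))) \<longlongrightarrow> Im (Ln z0)) (nhds z0)"
    using z0 by simp
  have rng: "- pi < Im (Ln z0)" "Im (Ln z0) < pi"
    using assms z0 by (simp_all add: mpi_less_Im_Ln Im_Ln_less_pi)
  have "eventually (\<lambda>z. - pi < Im (Ln z0) + Im (Ln (z / z0))) (nhds z0)"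
    "eventually (\<lambda>z. Im (Ln z0) + Im (Ln (z / z0)) < pi) (nhds z0)"
    using order_tendstoD [OF lim] rng by auto
  moreover have "eventually (\<lambda>z. z \<noteq> 0) (nhds z0)"
    using z0 t1_space_nhds by blast
  ultimately show ?thesis
  proof eventually_elim
    case (elim z)
    then have "Ln (z0 * (z / z0)) = Ln z0 + Ln (z / z0)"
      using z0 by (intro Ln_times_simple) auto
    then have "Ln z = Ln z0 + Ln (z / z0)" using z0 by simp
    then show ?case using elim z0
      by (auto simp: local_power_def principal_power_def powr_def exp_add [symmetric] algebra_simps)
  qed
qed

end

theory Submission
  imports Defs
begin

text \<open>
  Only small \<open>w\<close> matters, so crude bounds suffice. The polynomials \<open>gegenbauer_check \<nu> m\<close> have degree at
  most \<open>m\<close> and coefficients of size \<open>O(R\<^sup>m)\<close>, hence on \<open>[-1,1]\<close> each of their derivatives grows at most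
  exponentially in \<open>m\<close>, whereas \<open>(w/2)\<^sup>b\<^sup>m\<close> decays geometrically with arbitrarily small ratio, and
  \<open>1/\<Gamma>\<close> is bounded on right half-lines. So for small \<open>w\<close> the series may be differentiated termwise in
  \<open>t\<close>, and the result is holomorphic in \<open>w\<close> and bounded independently of \<open>w\<close> and \<open>t\<close>. Cauchy's
  inequality on the disc of radius \<open>\<bar>w\<bar>/2\<close> about \<open>w\<close> then gives the factor \<open>\<bar>w\<bar>\<^sup>-\<^sup>k\<close>.
\<close>

section \<open>Gegenbauer polynomials: exponential bounds for their coefficients and
  derivatives\<close>

lemma abs_gbinomial_le: "\<bar>(a::real) gchoose n\<bar> \<le> (1 + \<bar>a\<bar>) ^ n"
proof (induction n)
  case (Suc n)
  \<comment> \<open>Consecutive coefficients have ratio (a - n)/(n + 1), whose modulus is at most 1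
    + |a|.\<close>
  have "a gchoose Suc n = (a gchoose n) * ((a - real n) / (real n + 1))"
    by (simp add: gbinomial_prod_rev field_simps)
  then have "\<bar>a gchoose Suc n\<bar> = \<bar>a gchoose n\<bar> * (\<bar>a - real n\<bar> / (real n + 1))"
    by (simp add: abs_mult)
  also have "\<dots> \<le> (1 + \<bar>a\<bar>) ^ n * (1 + \<bar>a\<bar>)"
  proof (intro mult_mono Suc.IH)
    have "\<bar>a - real n\<bar> \<le> \<bar>a\<bar> + real n" by linarith
    also have "\<dots> \<le> (1 + \<bar>a\<bar>) * (real n + 1)" by (simp add: algebra_simps)
    finally show "\<bar>a - real n\<bar> / (real n + 1) \<le> 1 + \<bar>a\<bar>"
      by (simp add: divide_le_eq)
  qed auto
  finally show ?case by (simp add: mult.commute)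
qed auto

text \<open>Since X^2 - cX = X(X - c), extracting X^n leaves the coefficient of X^(m-n) in (X -
  c)^n, which the binomial theorem gives.\<close>

lemma fps_nth_quadratic_power:
  "fps_nth ((fps_X ^ 2 - fps_const c * fps_X) ^ n) m =
     (if n \<le> m then of_nat (n choose (m - n)) * (- c :: real) ^ (2 * n - m) else 0)"
proof -
  have "fps_X ^ 2 - fps_const c * fps_X = fps_X * (fps_X + fps_const (- c))"
    by (simp add: algebra_simps power2_eq_square flip: fps_const_neg)
  then have "(fps_X ^ 2 - fps_const c * fps_X) ^ n = fps_X ^ n * (fps_X + fps_const (- c)) ^ n"
    by (simp only: power_mult_distrib)
  moreover have "fps_nth ((fps_X + fps_const (- c)) ^ n) k = of_nat (n choose k) * (- c) ^ (n - k)" for k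
  proof -
    have "(fps_X + fps_const (- c)) ^ n =
        (\<Sum>j\<le>n. fps_const (of_nat (n choose j) * (- c) ^ (n - j)) * fps_X ^ j)"
      by (subst binomial_ring, intro sum.cong refl)
        (simp add: fps_of_nat [symmetric] fps_const_power ac_simps flip: fps_const_mult)
    then show ?thesis by (simp add: fps_sum_nth if_distrib cong: if_cong)
  qed
  ultimately show ?thesis
    by (simp only: fps_X_power_mult_nth) (auto simp: mult_2)
qed

text \<open>The coefficient of \<open>X\<^sup>m\<close> in \<open>(1 - 2 t X + X\<^sup>2)\<^sup>a\<close>, as a polynomial in \<open>t\<close>. Where \<open>2 * n - m\<close> is
  truncated, the binomial coefficient vanishes.\<close>
definition quadratic_power_poly :: "real \<Rightarrow> nat \<Rightarrow> real poly" where
  "quadratic_power_poly a m =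
     (\<Sum>n\<le>m. monom ((a gchoose n) * of_nat (n choose (m - n)) * (- 2) ^ (2 * n - m)) (2 * n - m))"

lemma poly_quadratic_power_poly:
  "poly (quadratic_power_poly a m) t =
     fps_nth (fps_compose (fps_binomial a) (fps_X ^ 2 - fps_const (2 * t) * fps_X)) m"
proof -
  have "(- (2 * t)) ^ j = (- 2) ^ j * t ^ j" for j
    by (simp flip: power_mult_distrib)
  then show ?thesis
    by (simp add: quadratic_power_poly_def fps_compose_nth fps_nth_quadratic_power poly_sum
        poly_monom atMost_atLeast0 mult.assoc)
qed

lemma degree_quadratic_power_poly: "degree (quadratic_power_poly a m) \<le> m"
  unfolding quadratic_power_poly_def
  by (intro degree_sum_le order.trans [OF degree_monom_le]) auto

text \<open>The 8 collects three factors 2^m: one from the binomial coefficient, one from the power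
  of -2, and one from the number m + 1 \<le> 2^m of summands.\<close>

lemma abs_coeff_quadratic_power_poly:
  "\<bar>coeff (quadratic_power_poly a m) i\<bar> \<le> (8 * (1 + \<bar>a\<bar>)) ^ m"
proof -
  have "\<bar>coeff (monom ((a gchoose n) * of_nat (n choose (m - n)) * (- 2) ^ (2 * n - m)) (2 * n - m)) i\<bar>
      \<le> (1 + \<bar>a\<bar>) ^ m * 2 ^ m * 2 ^ m" if "n \<le> m" for n
  proof -
    have "\<bar>(a gchoose n) * of_nat (n choose (m - n)) * (- 2) ^ (2 * n - m)\<bar> =
        \<bar>a gchoose n\<bar> * of_nat (n choose (m - n)) * 2 ^ (2 * n - m)"
      by (simp add: abs_mult power_abs)
    also have "\<dots> \<le> (1 + \<bar>a\<bar>) ^ m * 2 ^ m * 2 ^ m"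
    proof (intro mult_mono)
      show "\<bar>a gchoose n\<bar> \<le> (1 + \<bar>a\<bar>) ^ m"
        by (rule order.trans [OF abs_gbinomial_le power_increasing]) (use that in auto)
      have "n choose (m - n) \<le> 2 ^ n" by (rule binomial_le_pow2)
      also have "\<dots> \<le> 2 ^ m" using that by (intro power_increasing) auto
      finally show "real (n choose (m - n)) \<le> 2 ^ m"
        by (metis of_nat_le_iff of_nat_numeral of_nat_power)
      show "(2::real) ^ (2 * n - m) \<le> 2 ^ m" using that by (intro power_increasing) auto
    qed auto
    finally show ?thesis by auto
  qed
  then have "\<bar>coeff (quadratic_power_poly a m) i\<bar> \<le> (\<Sum>n\<le>m. (1 + \<bar>a\<bar>) ^ m * 2 ^ m * 2 ^ m)"
    unfolding quadratic_power_poly_def coeff_sum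
    by (intro order.trans [OF sum_abs] sum_mono) auto
  also have "\<dots> = real (Suc m) * ((1 + \<bar>a\<bar>) ^ m * 2 ^ m * 2 ^ m)" by simp
  also have "\<dots> \<le> 2 ^ m * ((1 + \<bar>a\<bar>) ^ m * 2 ^ m * 2 ^ m)"
  proof (rule mult_right_mono)
    have "Suc m \<le> 2 ^ m" by (simp add: Suc_leI)
    then show "real (Suc m) \<le> 2 ^ m" by (metis of_nat_le_iff of_nat_numeral of_nat_power)
  qed auto
  also have "\<dots> = (8 * (1 + \<bar>a\<bar>)) ^ m"
    by (simp flip: power_mult_distrib add: mult.commute)
  finally show ?thesis .
qed

text \<open>The exponent is negated because the generating function divides by the power; its
  numerator 1 - X^2 subtracts the coefficient two places earlier, which is absent for
  \<open>m < 2\<close>.\<close>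

definition gegenbauer_poly :: "real \<Rightarrow> nat \<Rightarrow> real poly" where
  "gegenbauer_poly \<nu> m = quadratic_power_poly (- (\<nu> + 1)) m -
     (if m < 2 then 0 else quadratic_power_poly (- (\<nu> + 1)) (m - 2))"

lemma gegenbauer_check_eq_poly: "gegenbauer_check \<nu> m t = poly (gegenbauer_poly \<nu> m) t"
proof -
  let ?q = "fps_X ^ 2 - fps_const (2 * t) * fps_X :: real fps"
  have "fps_binomial (- (\<nu> + 1)) * fps_binomial (\<nu> + 1) = 1"
    by (simp flip: fps_binomial_add_mult)
  then have "inverse (fps_binomial (\<nu> + 1)) = fps_binomial (- (\<nu> + 1))"
    by (intro fps_inverse_unique) (simp add: mult.commute)
  \<comment> \<open>Inversion commutes with substituting \<open>?q\<close>, because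
    \<open>?q\<close> has constant coefficient 0.\<close>
  then have "inverse (fps_compose (fps_binomial (\<nu> + 1)) ?q) =
      fps_compose (fps_binomial (- (\<nu> + 1))) ?q"
    using fps_inverse_compose[of ?q "fps_binomial (\<nu> + 1)"] by simp
  then have "(1 - fps_X ^ 2) / fps_compose (fps_binomial (\<nu> + 1)) ?q =
      fps_compose (fps_binomial (- (\<nu> + 1))) ?q -
      fps_X ^ 2 * fps_compose (fps_binomial (- (\<nu> + 1))) ?q"
    by (simp add: fps_divide_unit left_diff_distrib)
  then show ?thesis
    by (simp add: gegenbauer_check_def gegenbauer_poly_def poly_quadratic_power_poly
        fps_X_power_mult_nth)
qed

lemma degree_gegenbauer_poly: "degree (gegenbauer_poly \<nu> m) \<le> m"
  using degree_quadratic_power_poly[of "- (\<nu> + 1)" m]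
    degree_quadratic_power_poly[of "- (\<nu> + 1)" "m - 2"]
  by (auto simp: gegenbauer_poly_def intro!: degree_diff_le)

lemma abs_coeff_gegenbauer_poly:
  "\<bar>coeff (gegenbauer_poly \<nu> m) i\<bar> \<le> 2 * (8 * (1 + \<bar>\<nu> + 1\<bar>)) ^ m"
proof -
  let ?R = "8 * (1 + \<bar>\<nu> + 1\<bar>)"
  have bd: "\<bar>coeff (quadratic_power_poly (- (\<nu> + 1)) k) i\<bar> \<le> ?R ^ m" if "k \<le> m" for k
  proof -
    have "?R ^ k \<le> ?R ^ m" using that by (intro power_increasing) (simp_all add: distrib_left)
    then show ?thesis
      using abs_coeff_quadratic_power_poly[of "- (\<nu> + 1)" k i] by (simp only: abs_minus_cancel)
  qed
  from bd[of m] bd[of "m - 2"] show ?thesis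
    by (auto simp: gegenbauer_poly_def)
qed

text \<open>Each differentiation shifts the coefficients and multiplies them by an index. The degree
  bound is carried through the induction so that this index never exceeds m.\<close>

lemma coeff_iterated_pderiv_bound:
  fixes p :: "real poly"
  assumes "degree p \<le> m" "\<And>i. \<bar>coeff p i\<bar> \<le> B"
  shows "degree ((pderiv ^^ l) p) \<le> m \<and> (\<forall>i. \<bar>coeff ((pderiv ^^ l) p) i\<bar> \<le> real m ^ l * B)"
proof (induction l)
  case (Suc l)
  let ?q = "(pderiv ^^ l) p"
  have B: "0 \<le> B" using assms(2)[of 0] by linarith
  have "\<bar>coeff (pderiv ?q) i\<bar> \<le> real m * (real m ^ l * B)" for i
  proof (cases "Suc i \<le> m")
    case True
    then have "real (Suc i) * \<bar>coeff ?q (Suc i)\<bar> \<le> real m * (real m ^ l * B)"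
      using Suc by (intro mult_mono) auto
    then show ?thesis by (simp add: coeff_pderiv abs_mult)
  next
    case False
    then have "coeff ?q (Suc i) = 0" using Suc by (intro coeff_eq_0) auto
    then show ?thesis using B by (simp add: coeff_pderiv)
  qed
  then show ?case using Suc by (auto simp: degree_pderiv mult.assoc intro: order.trans[OF diff_le_self])
qed (use assms in auto)

text \<open>On [-1,1] the value is at most the sum of the moduli of the coefficients, hence at most
  (m + 1) m^l B. The estimate m + 1 \<le> 2^m turns the polynomial factor into a geometric one,
  which the powers of w can absorb.\<close>

lemma abs_iterated_pderiv_le:
  fixes p :: "real poly"
  assumes "degree p \<le> m" "\<And>i. \<bar>coeff p i\<bar> \<le> B" "\<bar>t\<bar> \<le> 1"
  shows "\<bar>poly ((pderiv ^^ l) p) t\<bar> \<le> (2 ^ Suc l) ^ m * B"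
proof -
  let ?q = "(pderiv ^^ l) p"
  have q: "degree ?q \<le> m" "\<And>i. \<bar>coeff ?q i\<bar> \<le> real m ^ l * B"
    using coeff_iterated_pderiv_bound[OF assms(1,2), of l] by auto
  have B: "0 \<le> B" using assms(2)[of 0] by linarith
  have "\<bar>poly ?q t\<bar> \<le> (\<Sum>i\<le>degree ?q. real m ^ l * B)"
    unfolding poly_altdef
  proof (intro order.trans [OF sum_abs] sum_mono)
    fix i
    have "\<bar>coeff ?q i\<bar> * \<bar>t\<bar> ^ i \<le> (real m ^ l * B) * 1"
      using q(2) assms(3) by (intro mult_mono power_le_one) (auto intro: order.trans[OF abs_ge_zero])
    then show "\<bar>coeff ?q i * t ^ i\<bar> \<le> real m ^ l * B" by (simp add: abs_mult power_abs)
  qed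
  also have "\<dots> \<le> real (Suc m) * real m ^ l * B"
    using q(1) B by (simp add: mult.assoc mult_right_mono)
  also have "\<dots> \<le> 2 ^ m * (2 ^ m) ^ l * B"
  proof (intro mult_right_mono mult_mono power_mono B)
    have "Suc m \<le> 2 ^ m" by (simp add: Suc_leI)
    then show "real (Suc m) \<le> 2 ^ m" by (metis of_nat_le_iff of_nat_numeral of_nat_power)
    then show "real m \<le> 2 ^ m" by simp
  qed auto
  also have "\<dots> = (2 ^ Suc l) ^ m * B"
    by (metis power_Suc power_mult mult.commute)
  finally show ?thesis .
qed

section \<open>The Bessel factor: uniform bound and holomorphy near 0\<close>

text \<open>Compactness handles arguments up to 2. Beyond that, 1/\<Gamma>(x) = x/\<Gamma>(x+1)
  shows that a unit step to the right from x \<ge> 1 does not increase the modulus.\<close>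

lemma rGamma_bounded_atLeast:
  obtains G :: real where "G > 0" "\<And>x. x \<ge> c \<Longrightarrow> \<bar>rGamma x\<bar> \<le> G"
proof -
  \<comment> \<open>The \<open>min\<close> keeps [1,2], the starting interval for the unit steps,
    inside the compact set even if c > 1.\<close>
  have "compact (rGamma ` {min c 1..2})"
    by (intro compact_continuous_image continuous_intros) auto
  then obtain G where G: "G > 0" "\<And>x. x \<in> {min c 1..2} \<Longrightarrow> \<bar>rGamma x\<bar> \<le> G"
    by (auto simp: bounded_pos dest!: compact_imp_bounded)
  have step: "\<bar>rGamma (x + real n)\<bar> \<le> G" if "x \<in> {1..2}" for x n
  proof (induction n)
    case 0
    then show ?case using G(2)[of x] that by auto
  next
    case (Suc n)
    have "1 * \<bar>rGamma (x + real n + 1)\<bar> \<le> \<bar>x + real n\<bar> * \<bar>rGamma (x + real n + 1)\<bar>"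
      using that by (intro mult_right_mono) auto
    also have "\<dots> = \<bar>rGamma (x + real n)\<bar>"
      by (simp only: abs_mult [symmetric] rGamma_plus1)
    finally have "\<bar>rGamma (x + real n + 1)\<bar> \<le> G" using Suc by linarith
    moreover have "x + real n + 1 = x + real (Suc n)" by simp
    ultimately show ?case by metis
  qed
  have "\<bar>rGamma x\<bar> \<le> G" if "x \<ge> c" for x
  proof (cases "x \<le> 2")
    case False
    define n where "n = nat (\<lfloor>x\<rfloor> - 1)"
    have "x - real n \<in> {1..2}" using False unfolding n_def by (auto; linarith)
    from step[OF this, of n] show ?thesis by simp
  qed (use that G(2)[of x] in auto)
  with G(1) show ?thesis by (rule that)
qed

text \<open>The M-test makes the partial sums converge uniformly, and uniform limits of holomorphic
  functions are holomorphic.\<close>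

lemma holomorphic_on_suminf:
  fixes f :: "nat \<Rightarrow> complex \<Rightarrow> complex"
  assumes "open S" "\<And>n. f n holomorphic_on S" "\<And>n z. z \<in> S \<Longrightarrow> norm (f n z) \<le> M n" "summable M"
  shows "(\<lambda>z. \<Sum>n. f n z) holomorphic_on S"
proof (rule holomorphic_uniform_sequence[where f = "\<lambda>n z. \<Sum>i<n. f i z"])
  have "uniform_limit S (\<lambda>n z. \<Sum>i<n. f i z) (\<lambda>z. \<Sum>n. f n z) sequentially"
    using assms(3,4) by (rule Weierstrass_m_test)
  moreover have "\<exists>d>0. cball z d \<subseteq> S" if "z \<in> S" for z
    using assms(1) that by (simp add: open_contains_cball)
  ultimately show "\<exists>d>0. cball z d \<subseteq> S \<and>
      uniform_limit (cball z d) (\<lambda>n z. \<Sum>i<n. f i z) (\<lambda>z. \<Sum>n. f n z) sequentially"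
    if "z \<in> S" for z
    using that by (meson uniform_limit_on_subset)
qed (intro holomorphic_on_sum assms)+

lemma bessel_I_tilde_term_le:
  fixes w :: complex
  assumes "norm w \<le> 2" "\<bar>rGamma (\<mu> + real j + 1)\<bar> \<le> G"
  shows "norm ((w / 2) ^ (2 * j) / fact j * of_real (rGamma (\<mu> + real j + 1))) \<le> G * (1 / fact j)"
proof -
  have "norm ((w / 2) ^ (2 * j)) \<le> 1"
    using assms(1) by (simp add: norm_power norm_divide power_le_one)
  then have "norm ((w / 2) ^ (2 * j)) * (1 / fact j) * \<bar>rGamma (\<mu> + real j + 1)\<bar> \<le> 1 * (1 / fact j) * G"
    using assms(2) by (intro mult_mono) auto
  then show ?thesis by (simp add: norm_mult norm_divide mult.commute)
qed

lemma sums_inverse_fact: "(\<lambda>j. 1 / fact j) sums exp (1::real)"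
  using exp_converges[of "1::real"] by (simp add: field_simps)

text \<open>\<open>G\<close> is left as a parameter so that one value can serve all orders b(m +
  \<nu>), which only grow with m when b > 0.\<close>

lemma bessel_I_tilde_bound:
  assumes "norm w \<le> 2" "\<And>x. x \<ge> \<mu> + 1 \<Longrightarrow> \<bar>rGamma x\<bar> \<le> G"
  shows "norm (bessel_I_tilde \<mu> w) \<le> G * exp 1"
proof -
  have s: "(\<lambda>j. G * (1 / fact j)) sums (G * exp 1)" by (intro sums_mult sums_inverse_fact)
  show ?thesis
    unfolding bessel_I_tilde_def sums_unique[OF s]
    by (intro norm_suminf_le bessel_I_tilde_term_le assms sums_summable[OF s]) auto
qed

lemma holomorphic_bessel_I_tilde: "bessel_I_tilde \<mu> holomorphic_on ball 0 2"
proof -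
  obtain G where G: "\<And>x. x \<ge> \<mu> + 1 \<Longrightarrow> \<bar>rGamma x\<bar> \<le> G"
    using rGamma_bounded_atLeast[of "\<mu> + 1"] by metis
  have "(\<lambda>w. \<Sum>j. (w / 2) ^ (2 * j) / fact j * of_real (rGamma (\<mu> + real j + 1)))
      holomorphic_on ball 0 2"
  proof (rule holomorphic_on_suminf[where M = "\<lambda>j. G * (1 / fact j)"])
    show "summable (\<lambda>j. G * (1 / fact j :: real))"
      using sums_inverse_fact by (intro summable_mult) (rule sums_summable)
    show "norm ((w / 2) ^ (2 * j) / fact j * of_real (rGamma (\<mu> + real j + 1))) \<le> G * (1 / fact j)"
      if "w \<in> ball 0 2" for j and w :: complex
      using that by (intro bessel_I_tilde_term_le G) auto
    show "(\<lambda>w. (w / 2) ^ (2 * j) / fact j * of_real (rGamma (\<mu> + real j + 1))) holomorphic_on ball 0 2"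
      for j
      by (intro holomorphic_on_mult holomorphic_on_const holomorphic_on_divide holomorphic_on_power
          holomorphic_on_ident) auto
  qed auto
  then show ?thesis unfolding bessel_I_tilde_def [abs_def] .
qed

section \<open>Modulus and holomorphy of the local branch of the power\<close>

text \<open>The exponent is real, so the choice of argument affects only a factor of modulus
  1.\<close>

lemma norm_local_power:
  assumes "z0 \<noteq> 0" "z \<noteq> 0"
  shows "norm (local_power z0 z s) = norm z powr s"
  using assms
  by (simp add: local_power_def principal_power_polar norm_mult norm_divide powr_divide)

text \<open>Dividing by z0 maps the disc to the unit disc about 1. This lies in the right half-plane
  and so avoids the cut of the principal power.\<close>

lemma holomorphic_local_power:
  assumes "z0 \<noteq> 0"
  shows "(\<lambda>z. local_power z0 z s) holomorphic_on ball z0 (norm z0)"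
proof -
  have "z / z0 \<notin> \<real>\<^sub>\<le>\<^sub>0" if "z \<in> ball z0 (norm z0)" for z
  proof
    assume "z / z0 \<in> \<real>\<^sub>\<le>\<^sub>0"
    then have "1 \<le> Re (1 - z / z0)" by (auto simp: complex_nonpos_Reals_iff)
    also have "\<dots> \<le> norm (1 - z / z0)" by (rule complex_Re_le_cmod)
    also have "1 - z / z0 = (z0 - z) / z0" using assms by (simp add: field_simps)
    also have "norm \<dots> < 1" using that assms by (simp add: norm_divide dist_norm)
    finally show False by simp
  qed
  then have "(\<lambda>z. z0 powr of_real s * (z / z0) powr of_real s) holomorphic_on ball z0 (norm z0)"
    using assms by (intro holomorphic_intros) auto
  then show ?thesis
    by (cases "s = 0") (auto simp: local_power_def principal_power_def)
qed

section \<open>Termwise differentiation in t\<close>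

text \<open>A common majorant for all orders up to l makes every differentiated series converge
  uniformly on [-1,1], so the derivatives can be taken termwise one at a time, one-sidedly at the
  endpoints.\<close>

lemma t_deriv_iterated_series:
  fixes u :: "nat \<Rightarrow> complex" and p :: "nat \<Rightarrow> real poly"
  assumes "\<And>i m t. i \<le> l \<Longrightarrow> t \<in> {-1..1} \<Longrightarrow> norm (u m) * \<bar>poly ((pderiv ^^ i) (p m)) t\<bar> \<le> M m"
    and "summable M" and "t \<in> {-1..1}"
  shows "(t_deriv ^^ l) (\<lambda>s. c * (\<Sum>m. u m * of_real (poly (p m) s))) t =
    c * (\<Sum>m. u m * of_real (poly ((pderiv ^^ l) (p m)) t))"
  using assms(1,3)
proof (induction l arbitrary: t)
  case (Suc l)
  let ?d = "\<lambda>i m t. u m * of_real (poly ((pderiv ^^ i) (p m)) t)"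
  let ?g = "(t_deriv ^^ l) (\<lambda>s. c * (\<Sum>m. u m * of_real (poly (p m) s)))"
  have bound: "norm (?d i m s) \<le> M m" if "i \<le> Suc l" "s \<in> {-1..1}" for i m s
    using Suc.prems(1)[OF that] by (simp add: norm_mult)
  have "uniform_limit {-1..1} (\<lambda>n s. \<Sum>m<n. ?d (Suc l) m s) (\<lambda>s. \<Sum>m. ?d (Suc l) m s) sequentially"
    by (rule Weierstrass_m_test[where f = "?d (Suc l)"]) (use bound[of "Suc l"] assms(2) in blast)+
  \<comment> \<open>Uniform convergence is restated for the linear maps h \<mapsto> h f', as
    \<open>has_derivative_series\<close> demands.\<close>
  then have unif: "\<forall>\<^sub>F n in sequentially. \<forall>s\<in>{-1..1}. \<forall>h.
      norm ((\<Sum>m<n. h *\<^sub>R ?d (Suc l) m s) - h *\<^sub>R (\<Sum>m. ?d (Suc l) m s)) \<le> e * norm h"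
    if "e > 0" for e
  proof -
    have "\<forall>\<^sub>F n in sequentially. \<forall>s\<in>{-1..1}.
        dist (\<Sum>m<n. ?d (Suc l) m s) (\<Sum>m. ?d (Suc l) m s) < e"
      using \<open>uniform_limit _ _ _ _\<close> that by (rule uniform_limitD)
    then show ?thesis
    proof eventually_elim
      case (elim n)
      have "norm ((\<Sum>m<n. h *\<^sub>R ?d (Suc l) m s) - h *\<^sub>R (\<Sum>m. ?d (Suc l) m s)) =
          norm h * dist (\<Sum>m<n. ?d (Suc l) m s) (\<Sum>m. ?d (Suc l) m s)" for s h
        by (simp only: dist_norm norm_scaleR real_norm_def flip: scaleR_sum_right scaleR_diff_right)
      then show ?case
        using elim by (simp only: mult.commute[of e]) (intro ballI allI mult_left_mono, auto intro: less_imp_le)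
    qed
  qed
  have "\<exists>g. \<forall>s\<in>{-1..1}. (\<lambda>m. ?d l m s) sums g s \<and>
      (g has_derivative (\<lambda>h. h *\<^sub>R (\<Sum>m. ?d (Suc l) m s))) (at s within {-1..1})"
  proof (rule has_derivative_series[where f' = "\<lambda>m s h. h *\<^sub>R ?d (Suc l) m s" and x = 0])
    show "(?d l m has_derivative (\<lambda>h. h *\<^sub>R ?d (Suc l) m s)) (at s within {-1..1})" for m s
    proof -
      have "(poly ((pderiv ^^ l) (p m)) has_real_derivative poly ((pderiv ^^ Suc l) (p m)) s)
          (at s within {-1..1})"
        using has_field_derivative_at_within[OF poly_DERIV[of "(pderiv ^^ l) (p m)" s]] by simp
      then have "(?d l m has_vector_derivative ?d (Suc l) m s) (at s within {-1..1})"
        by (intro has_vector_derivative_mult_right has_vector_derivative_of_real)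
      then show ?thesis by (simp add: has_vector_derivative_def)
    qed
    have "summable (\<lambda>m. ?d l m 0)"
      by (rule summable_comparison_test'[OF assms(2)]) (use bound in auto)
    then show "(\<lambda>m. ?d l m 0) sums (\<Sum>m. ?d l m 0)" by (rule summable_sums)
  qed (use unif in auto)
  then obtain g where g: "\<And>s. s \<in> {-1..1} \<Longrightarrow> (\<lambda>m. ?d l m s) sums g s"
    "\<And>s. s \<in> {-1..1} \<Longrightarrow> (g has_vector_derivative (\<Sum>m. ?d (Suc l) m s)) (at s within {-1..1})"
    unfolding has_vector_derivative_def by blast
  \<comment> \<open>The induction hypothesis identifies \<open>?g\<close> with the series only on
    [-1,1]; this suffices because the derivative is taken within that interval.\<close>
  have "(?g has_vector_derivative c * (\<Sum>m. ?d (Suc l) m t)) (at t within {-1..1})"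
  proof (rule has_vector_derivative_transform)
    show "((\<lambda>s. c * g s) has_vector_derivative c * (\<Sum>m. ?d (Suc l) m t)) (at t within {-1..1})"
      using g(2) Suc.prems(2) by (intro has_vector_derivative_mult_right)
    show "?g s = c * g s" if "s \<in> {-1..1}" for s
      using Suc.IH[of s] Suc.prems(1) that g(1)[OF that] by (simp add: sums_iff)
  qed (rule Suc.prems(2))
  then have "t_deriv ?g t = c * (\<Sum>m. ?d (Suc l) m t)"
    unfolding t_deriv_def using Suc.prems(2)
    by (intro vector_derivative_within_closed_interval) auto
  then show ?case by simp
qed auto

section \<open>Choice of constants, uniform bound on a disc about w, and Cauchy's inequality\<close>

theorem theorem3p5:
  fixes b \<nu> :: real and k l :: nat
  assumes "b > 0" and "1 + b * \<nu> > 0"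
  shows "\<exists>C>0. \<exists>\<epsilon>>0. \<forall>t\<in>{-1..1}. \<forall>w::complex. w \<noteq> 0 \<and> norm w < \<epsilon> \<longrightarrow>
           norm (scriptI_deriv k l b \<nu> w t) \<le> C * norm w powi (- int k)"
proof -
  obtain G where G: "G > 0" "\<And>x. x \<ge> b * \<nu> + 1 \<Longrightarrow> \<bar>rGamma x\<bar> \<le> G"
    using rGamma_bounded_atLeast by metis
  define c :: complex where "c = of_real (Gamma (b * \<nu> + 1))"
  \<comment> \<open>\<open>R\<close> is the exponential growth rate in m of the first l derivatives
    of the Gegenbauer polynomials. \<open>\<delta>\<close> then solves
    \<open>\<delta> powr b * R = 1 / 2\<close>, so that the terms of the series are dominated by the
    geometric sequence \<open>M\<close>.\<close>
  define R where "R = 2 ^ Suc l * (8 * (1 + \<bar>\<nu> + 1\<bar>))"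
  define \<delta> where "\<delta> = (1 / (2 * R)) powr (1 / b)"
  define M where "M m = 2 * (G * exp 1) * (1 / 2) ^ m" for m :: nat
  let ?p = "gegenbauer_poly \<nu>"
  have R: "R \<ge> 1"
  proof -
    have "1 * 1 \<le> 2 ^ Suc l * (8 * (1 + \<bar>\<nu> + 1\<bar>))"
      by (intro mult_mono one_le_power) auto
    then show ?thesis by (simp add: R_def)
  qed
  have \<delta>: "\<delta> > 0" "\<delta> \<le> 1" "\<delta> powr b * R = 1 / 2"
    using R assms(1) by (auto simp: \<delta>_def powr_powr intro!: powr_le1)
  have M: "summable M" unfolding M_def by (intro summable_mult summable_geometric) auto
  have poly_bound: "\<bar>poly ((pderiv ^^ i) (?p m)) t\<bar> \<le> 2 * R ^ m"
    if "i \<le> l" "t \<in> {-1..1}" for i m t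
  proof -
    have "\<bar>poly ((pderiv ^^ i) (?p m)) t\<bar> \<le> (2 ^ Suc i) ^ m * (2 * (8 * (1 + \<bar>\<nu> + 1\<bar>)) ^ m)"
      using that by (intro abs_iterated_pderiv_le degree_gegenbauer_poly abs_coeff_gegenbauer_poly) auto
    also have "\<dots> \<le> (2 ^ Suc l) ^ m * (2 * (8 * (1 + \<bar>\<nu> + 1\<bar>)) ^ m)"
      using that by (intro mult_right_mono power_mono power_increasing) auto
    finally show ?thesis by (simp add: R_def power_mult_distrib mult_ac)
  qed
  \<comment> \<open>The summand 1 makes the constant positive once the rest is known to be
    nonnegative.\<close>
  have main: "norm (scriptI_deriv k l b \<nu> w t) \<le> (fact k * (norm c * suminf M) * 2 ^ k + 1) * norm w powi (- int k)"
    if t: "t \<in> {-1..1}" and w: "w \<noteq> 0" "norm w < \<delta>" for t w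
  proof -
    define u where "u z m = local_power (w / 2) (z / 2) (b * real m) * bessel_I_tilde (b * (real m + \<nu>)) z"
      for z m
    define F where "F z = (t_deriv ^^ l) (\<lambda>s. scriptI_branch w b \<nu> z s) t" for z
    \<comment> \<open>This disc omits 0, so the branch at w is holomorphic on it. Its points satisfy
      |z| < 2|w|, hence |z/2| < \<delta>, and |z| < 2 because \<delta> \<le> 1.\<close>
    let ?B = "ball w (norm w)"
    have B: "z \<noteq> 0 \<and> norm (z / 2) < \<delta> \<and> norm z < 2" if "z \<in> ?B" for z
    proof -
      have "norm z < 2 * norm w"
        using that norm_triangle_sub[of z w] by (simp add: dist_norm norm_minus_commute)
      then show ?thesis using that w \<delta>(2) by (auto simp: norm_divide)
    qed
    have bound: "norm (u z m) * \<bar>poly ((pderiv ^^ i) (?p m)) s\<bar> \<le> M m"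
      if "z \<in> ?B" "i \<le> l" "s \<in> {-1..1}" for z i m s
    proof -
      have "norm (u z m) \<le> (\<delta> powr b) ^ m * (G * exp 1)"
        unfolding u_def norm_mult
      proof (intro mult_mono)
        have "norm (z / 2) powr (b * real m) \<le> \<delta> powr (b * real m)"
          using B[OF that(1)] assms(1) by (intro powr_mono2) auto
        then show "norm (local_power (w / 2) (z / 2) (b * real m)) \<le> (\<delta> powr b) ^ m"
          using B[OF that(1)] w \<delta>(1) by (simp add: norm_local_power powr_powr [symmetric] powr_realpow)
        have "b * \<nu> + 1 \<le> b * (real m + \<nu>) + 1" using assms(1) by (simp add: distrib_left)
        then show "norm (bessel_I_tilde (b * (real m + \<nu>)) z) \<le> G * exp 1"
          using B[OF that(1)] G(2) by (intro bessel_I_tilde_bound) auto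
      qed auto
      then have "norm (u z m) * \<bar>poly ((pderiv ^^ i) (?p m)) s\<bar> \<le>
          ((\<delta> powr b) ^ m * (G * exp 1)) * (2 * R ^ m)"
        using that G(1) by (intro mult_mono poly_bound) auto
      also have "\<dots> = 2 * (G * exp 1) * (\<delta> powr b * R) ^ m"
        by (simp add: power_mult_distrib)
      finally show ?thesis by (simp add: M_def \<delta>(3))
    qed
    have F_eq: "F z = c * (\<Sum>m. u z m * of_real (poly ((pderiv ^^ l) (?p m)) t))" if "z \<in> ?B" for z
    proof -
      have "scriptI_branch w b \<nu> z = (\<lambda>s. c * (\<Sum>m. u z m * of_real (poly (?p m) s)))"
        by (simp add: fun_eq_iff scriptI_branch_def scriptI_series_def c_def u_def gegenbauer_check_eq_poly)
      then show ?thesis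
        unfolding F_def using t_deriv_iterated_series[OF bound[OF that] M t] by (simp only:)
    qed
    have "(\<lambda>z. \<Sum>m. u z m * of_real (poly ((pderiv ^^ l) (?p m)) t)) holomorphic_on ?B"
    proof (rule holomorphic_on_suminf[OF open_ball _ _ M])
      fix m
      \<comment> \<open>The branch is based at w/2, and halving maps \<open>?B\<close> into the disc
        on which that branch is holomorphic.\<close>
      have "(\<lambda>z. local_power (w / 2) (z / 2) (b * real m)) holomorphic_on ?B"
      proof (rule holomorphic_on_compose_gen[unfolded o_def, where g = "\<lambda>z. local_power (w / 2) z (b * real m)"])
        show "(\<lambda>z. z / 2) ` ?B \<subseteq> ball (w / 2) (norm (w / 2))"
          by (auto simp: dist_norm norm_divide simp flip: diff_divide_distrib)
        show "(\<lambda>z. local_power (w / 2) z (b * real m)) holomorphic_on ball (w / 2) (norm (w / 2))"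
          using w by (intro holomorphic_local_power) simp
      qed (auto intro!: holomorphic_intros)
      moreover have "bessel_I_tilde (b * (real m + \<nu>)) holomorphic_on ?B"
        using B by (intro holomorphic_on_subset[OF holomorphic_bessel_I_tilde]) auto
      ultimately show "(\<lambda>z. u z m * of_real (poly ((pderiv ^^ l) (?p m)) t)) holomorphic_on ?B"
        unfolding u_def by (intro holomorphic_intros)
      show "norm (u z m * of_real (poly ((pderiv ^^ l) (?p m)) t)) \<le> M m" if "z \<in> ?B" for z
        using bound[OF that order.refl t] by (simp add: norm_mult)
    qed
    then have "(\<lambda>z. c * (\<Sum>m. u z m * of_real (poly ((pderiv ^^ l) (?p m)) t))) holomorphic_on ?B"
      by (intro holomorphic_intros)
    then have holF: "F holomorphic_on ?B"
      by (rule holomorphic_transform) (simp only: F_eq)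
    have F_bound: "norm (F z) \<le> norm c * suminf M" if "z \<in> ?B" for z
      unfolding F_eq[OF that] norm_mult
    proof (intro mult_left_mono norm_suminf_le M)
      show "norm (u z m * of_real (poly ((pderiv ^^ l) (?p m)) t)) \<le> M m" for m
        using bound[OF that order.refl t] by (simp add: norm_mult)
    qed simp
    \<comment> \<open>Cauchy's inequality uses a closed disc, so the radius is halved to stay inside
      \<open>?B\<close>; this is the source of the factor 2^k.\<close>
    have sub: "cball w (norm w / 2) \<subseteq> ?B"
    proof
      fix z assume "z \<in> cball w (norm w / 2)"
      then have "dist w z \<le> norm w / 2" by simp
      also have "\<dots> < norm w" using w by simp
      finally show "z \<in> ?B" by simp
    qed
    have "norm ((deriv ^^ k) F w) \<le> fact k * (norm c * suminf M) / (norm w / 2) ^ k"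
    proof (rule Cauchy_inequality)
      show "F holomorphic_on ball w (norm w / 2)"
        using holF sub by (meson ball_subset_cball holomorphic_on_subset)
      show "continuous_on (cball w (norm w / 2)) F"
        using holF sub by (meson holomorphic_on_imp_continuous_on holomorphic_on_subset)
      show "norm (F z) \<le> norm c * suminf M" if "norm (w - z) = norm w / 2" for z
        using that w by (intro F_bound) (simp only: mem_ball dist_norm, simp)
    qed (use w in auto)
    also have "\<dots> = fact k * (norm c * suminf M) * 2 ^ k * norm w powi (- int k)"
      by (simp add: power_int_minus field_simps)
    also have "\<dots> \<le> (fact k * (norm c * suminf M) * 2 ^ k + 1) * norm w powi (- int k)"
      by (intro mult_right_mono) auto
    finally show ?thesis by (simp add: scriptI_deriv_def F_def [abs_def])
  qed
  have "0 \<le> suminf M" using M G(1) by (intro suminf_nonneg) (auto simp: M_def)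
  then have "0 < fact k * (norm c * suminf M) * 2 ^ k + 1"
    by (intro add_nonneg_pos mult_nonneg_nonneg) auto
  with main \<delta>(1) show ?thesis by blast
qed

end
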